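(* There are absolute constants $c,c'>0$ such that for infinitely many natural numbers $n$ there is a function $f_n:\{0,1\}^{n^2}\to\{0,1\}$ with $bs(f_n)\le c\,n$ and $bs^*(f_n)\ge c'\,n^{3/2}$. Therefore $\mathrm{crit}(bs^*,bs)\ge 3/2$.
   Context: For $x\in\{0,1\}^N$ and $B\subseteq[N]$, $x\oplus B$ is $x$ with the bits in $B$ flipped; a block of $f$ at $x$ is $B$ with $f(x\oplus B)\ne f(x)$. $bs_x(f)$ is the maximum number of pairwise disjoint blocks at $x$; $bs^*_x(f)$ is the maximum of $\sum_B\lambda(B)$ over nonnegative $\lambda$ on blocks at $x$ with $\sum_{B\ni i}\lambda(B)\le1$ for every $i$; $m(f)=\max_x m_x(f)$. For complexity measures $a,b$ (maps from boolean functions to reals), write $a\le_r b$ if there are constants $C_1,C_2$ with $a(f)\le C_1 b(f)^r+C_2$ for every boolean function $f$; $\mathrm{crit}(a,b)$ is the infimum of all $r$ with $a\le_r b$. *)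

theory Defs
  imports "HOL-Library.Disjoint_Sets" "HOL-Library.Extended_Real"
begin

text \<open>
  A boolean function on \<open>N\<close> bits is given by \<open>N\<close> together with \<open>f :: bool list \<Rightarrow> bool\<close>, of which only
  the values on lists of length \<open>N\<close> are ever used. Coordinates are numbered \<open>0, \<dots>, N - 1\<close>.
\<close>

type_synonym complexity_measure = "nat \<Rightarrow> (bool list \<Rightarrow> bool) \<Rightarrow> real"

definition cube :: "nat \<Rightarrow> bool list set" where
  "cube N = {x. length x = N}"

definition flip :: "bool list \<Rightarrow> nat set \<Rightarrow> bool list" where
  "flip x B = map (\<lambda>i. if i \<in> B then \<not> x ! i else x ! i) [0..<length x]"

definition blocks :: "nat \<Rightarrow> (bool list \<Rightarrow> bool) \<Rightarrow> bool list \<Rightarrow> nat set set" where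
  "blocks N f x = {B. B \<subseteq> {..<N} \<and> f (flip x B) \<noteq> f x}"

definition bs_at :: "nat \<Rightarrow> (bool list \<Rightarrow> bool) \<Rightarrow> bool list \<Rightarrow> nat" where
  "bs_at N f x = Max {card P | P. P \<subseteq> blocks N f x \<and> disjoint P}"

definition bs :: "nat \<Rightarrow> (bool list \<Rightarrow> bool) \<Rightarrow> nat" where
  "bs N f = Max (bs_at N f ` cube N)"

definition fractional_packing ::
  "nat \<Rightarrow> (bool list \<Rightarrow> bool) \<Rightarrow> bool list \<Rightarrow> (nat set \<Rightarrow> real) \<Rightarrow> bool" where
  "fractional_packing N f x w \<longleftrightarrow>
     (\<forall>B \<in> blocks N f x. w B \<ge> 0) \<and>
     (\<forall>i < N. (\<Sum>B \<in> {B \<in> blocks N f x. i \<in> B}. w B) \<le> 1)"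

text \<open>
  The set of packing values is infinite in general, so its maximum is written as \<open>Sup\<close>; it is the
  optimum of a feasible bounded linear program (the bound is \<open>N\<close>, see below), hence attained.
\<close>

definition bs_star_at :: "nat \<Rightarrow> (bool list \<Rightarrow> bool) \<Rightarrow> bool list \<Rightarrow> real" where
  "bs_star_at N f x = Sup {(\<Sum>B \<in> blocks N f x. w B) | w. fractional_packing N f x w}"

definition bs_star :: complexity_measure where
  "bs_star N f = Max (bs_star_at N f ` cube N)"

definition le_exp :: "real \<Rightarrow> complexity_measure \<Rightarrow> complexity_measure \<Rightarrow> bool" where
  "le_exp r a b \<longleftrightarrow> (\<exists>C\<^sub>1 C\<^sub>2 :: real. \<forall>N f. a N f \<le> C\<^sub>1 * b N f powr r + C\<^sub>2)"

text \<open>Extended reals, so that the infimum is \<open>\<infinity>\<close> if no exponent works.\<close>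

definition crit :: "complexity_measure \<Rightarrow> complexity_measure \<Rightarrow> ereal" where
  "crit a b = Inf {ereal r | r. le_exp r a b}"

lemma finite_blocks: "finite (blocks N f x)"
  by (rule finite_subset[of _ "Pow {..<N}"]) (auto simp: blocks_def)

lemma flip_empty: "flip x {} = x"
  by (simp add: flip_def map_nth)

lemma fractional_packing_zero: "fractional_packing N f x (\<lambda>_. 0)"
  by (simp add: fractional_packing_def)

lemma fractional_packing_le:
  assumes "fractional_packing N f x w"
  shows "(\<Sum>B \<in> blocks N f x. w B) \<le> real N"
proof -
  let ?S = "blocks N f x"
  have fin: "finite ?S" by (rule finite_blocks)
  have nonneg: "w B \<ge> 0" if "B \<in> ?S" for B
    using assms that by (auto simp: fractional_packing_def)
  have "(\<Sum>B \<in> ?S. w B) \<le> (\<Sum>B \<in> ?S. \<Sum>i<N. if i \<in> B then w B else 0)"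
  proof (rule sum_mono)
    fix B assume B: "B \<in> ?S"
    then have "B \<noteq> {}" and sub: "B \<subseteq> {..<N}" by (auto simp: blocks_def flip_empty)
    then obtain i where "i \<in> B" "i < N" by auto
    then have "w B = (if i \<in> B then w B else 0)" by simp
    also have "\<dots> \<le> (\<Sum>i<N. if i \<in> B then w B else 0)"
      using \<open>i < N\<close> nonneg[OF B] by (intro member_le_sum) auto
    finally show "w B \<le> (\<Sum>i<N. if i \<in> B then w B else 0)" .
  qed
  also have "\<dots> = (\<Sum>i<N. \<Sum>B \<in> {B \<in> ?S. i \<in> B}. w B)"
    by (subst sum.swap) (simp add: sum.inter_filter[OF fin])
  also have "\<dots> \<le> (\<Sum>i<N. 1)"
    using assms by (intro sum_mono) (auto simp: fractional_packing_def)
  finally show ?thesis by simp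
qed

end

theory Submission
  imports Defs
begin

text \<open>
  Write \<open>n = m\<^sup>2\<close> and read \<open>n\<^sup>2\<close> bits as \<open>n\<close> boolean \<open>m \<times> m\<close> grids. The witness accepts if some grid is
  the indicator of a cross, that is, of the union of row \<open>v\<close> and column \<open>v\<close> for some \<open>v < m\<close>.

  At an accepted input every block meets the grid holding a cross, so there are at most \<open>n\<close> disjoint
  blocks. At a rejected input each block creates a cross in some grid, and no grid serves four
  disjoint blocks, say with crosses \<open>s, t, u, v\<close>: the cell \<open>(s, t)\<close> lies in the crosses \<open>s\<close> and \<open>t\<close> but
  not in \<open>u\<close> and \<open>v\<close>, so either the first two or the last two blocks both flip it. Hence block
  sensitivity is at most \<open>3 n\<close>. At the zero input each cell lies in at most two crosses, so weight
  \<open>1/2\<close> on each of the \<open>n m\<close> crosses is a fractional packing of value \<open>n\<^sup>3\<^sup>/\<^sup>2 / 2\<close>.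
\<close>

section \<open>Bounds on both sensitivities from packings\<close>

lemma length_flip [simp]: "length (flip x B) = length x"
  by (simp add: flip_def)

lemma nth_flip: "i < length x \<Longrightarrow> flip x B ! i = (if i \<in> B then \<not> x ! i else x ! i)"
  by (simp add: flip_def)

lemma finite_cube: "finite (cube N)"
  unfolding cube_def using finite_lists_length_eq[of "UNIV :: bool set" N] by simp

lemma cube_nonempty: "cube N \<noteq> {}"
  unfolding cube_def using length_replicate[of N True] by blast

lemma bs_le:
  assumes "\<And>x P. length x = N \<Longrightarrow> P \<subseteq> blocks N f x \<Longrightarrow> disjoint P \<Longrightarrow> card P \<le> b"
  shows "bs N f \<le> b"
proof -
  have "bs_at N f x \<le> b" if "x \<in> cube N" for x
  proof -
    let ?S = "{card P | P. P \<subseteq> blocks N f x \<and> disjoint P}"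
    have "?S \<subseteq> card ` Pow (blocks N f x)" by auto
    then have "finite ?S"
      by (rule finite_subset) (simp add: finite_blocks)
    \<comment> \<open>The empty packing makes the set nonempty, as \<open>Max_le_iff\<close>
      demands.\<close>
    moreover have "card ({} :: nat set set) \<in> ?S"
      by (intro CollectI exI[of _ "{}"]) (auto simp: disjoint_def)
    ultimately show ?thesis
      unfolding bs_at_def using assms that by (subst Max_le_iff) (auto simp: cube_def)
  qed
  then show ?thesis
    unfolding bs_def by (subst Max_le_iff) (auto simp: finite_cube cube_nonempty)
qed

text \<open>A real \<open>Sup\<close> dominates the members of a set only if that set is bounded
  above; \<open>fractional_packing_le\<close> supplies the bound.\<close>

lemma bs_star_ge:
  assumes "length x = N" "fractional_packing N f x w"
  shows "(\<Sum>B \<in> blocks N f x. w B) \<le> bs_star N f"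
proof -
  have "(\<Sum>B \<in> blocks N f x. w B) \<le> bs_star_at N f x"
    unfolding bs_star_at_def
  proof (rule cSup_upper)
    show "bdd_above {(\<Sum>B \<in> blocks N f x. w B) | w. fractional_packing N f x w}"
      by (intro bdd_aboveI[of _ "real N"]) (auto simp: fractional_packing_le)
  qed (use assms in auto)
  also have "\<dots> \<le> bs_star N f"
    unfolding bs_star_def using assms by (intro Max_ge finite_imageI finite_cube) (auto simp: cube_def)
  finally show ?thesis .
qed

section \<open>Grids and crosses\<close>

definition cell :: "nat \<Rightarrow> nat \<Rightarrow> nat \<Rightarrow> nat \<Rightarrow> nat" where
  "cell m k a b = (k * m + a) * m + b"

definition is_cross :: "nat \<Rightarrow> bool list \<Rightarrow> nat \<Rightarrow> nat \<Rightarrow> bool" where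
  "is_cross m x k v \<longleftrightarrow> (\<forall>a<m. \<forall>b<m. x ! cell m k a b \<longleftrightarrow> a = v \<or> b = v)"

definition has_cross :: "nat \<Rightarrow> bool list \<Rightarrow> bool" where
  "has_cross m x \<longleftrightarrow> (\<exists>k<m\<^sup>2. \<exists>v<m. is_cross m x k v)"

text \<open>Flipping these indices turns an all-false grid \<open>k\<close> into the cross at
  \<open>v\<close>.\<close>

definition cross :: "nat \<Rightarrow> nat \<Rightarrow> nat \<Rightarrow> nat set" where
  "cross m k v = {cell m k a b | a b. a < m \<and> b < m \<and> (a = v \<or> b = v)}"

lemma mult_add_less:
  assumes "q < p" "r < m"
  shows "q * m + r < p * (m :: nat)"
proof -
  have "q * m + r < Suc q * m" using assms by simp
  also have "\<dots> \<le> p * m" using assms by (intro mult_le_mono1) simp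
  finally show ?thesis .
qed

lemma cell_less:
  assumes "k < m\<^sup>2" "a < m" "b < m"
  shows "cell m k a b < (m\<^sup>2)\<^sup>2"
proof -
  have "cell m k a b < (m\<^sup>2 * m) * m"
    unfolding cell_def using assms by (intro mult_add_less)
  then show ?thesis by (simp add: power2_eq_square mult.assoc)
qed

text \<open>The index is a base \<open>m\<close> numeral with low digits \<open>a\<close> and
  \<open>b\<close> and leading part \<open>k\<close>, so \<open>div\<close> and \<open>mod\<close>
  by \<open>m\<close> recover all three.\<close>

lemma cell_eq_iff:
  assumes "a < m" "b < m" "a' < m" "b' < m"
  shows "cell m k a b = cell m k' a' b' \<longleftrightarrow> k = k' \<and> a = a' \<and> b = b'"
proof
  assume eq: "cell m k a b = cell m k' a' b'"
  have "b = b'"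
    using arg_cong[OF eq, of "\<lambda>i. i mod m"] assms by (simp add: cell_def)
  moreover have row: "k * m + a = k' * m + a'"
    using arg_cong[OF eq, of "\<lambda>i. i div m"] assms by (simp add: cell_def)
  moreover have "a = a'"
    using arg_cong[OF row, of "\<lambda>i. i mod m"] assms by simp
  moreover have "k = k'"
    using arg_cong[OF row, of "\<lambda>i. i div m"] assms by simp
  ultimately show "k = k' \<and> a = a' \<and> b = b'" by simp
qed simp

lemma cell_in_cross_iff:
  assumes "a < m" "b < m"
  shows "cell m k a b \<in> cross m k' v \<longleftrightarrow> k = k' \<and> (a = v \<or> b = v)"
  unfolding cross_def using assms cell_eq_iff by blast

lemma cross_subset: "k < m\<^sup>2 \<Longrightarrow> cross m k v \<subseteq> {..<(m\<^sup>2)\<^sup>2}"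
  unfolding cross_def using cell_less by blast

lemma nth_flip_cell:
  assumes "length x = (m\<^sup>2)\<^sup>2" "k < m\<^sup>2" "a < m" "b < m"
  shows "flip x B ! cell m k a b = (if cell m k a b \<in> B then \<not> x ! cell m k a b else x ! cell m k a b)"
  using assms cell_less by (intro nth_flip) metis

section \<open>Upper bound on block sensitivity\<close>

lemma card_disjoint_blocks_accepted:
  assumes x: "length x = (m\<^sup>2)\<^sup>2" "has_cross m x"
    and P: "P \<subseteq> blocks ((m\<^sup>2)\<^sup>2) (has_cross m) x" "disjoint P"
  shows "card P \<le> m\<^sup>2"
proof -
  obtain k v where k: "k < m\<^sup>2" and v: "v < m" and cr: "is_cross m x k v"
    using x by (auto simp: has_cross_def)
  define G where "G = (\<lambda>(a, b). cell m k a b) ` ({..<m} \<times> {..<m})"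
  have cardG: "card G \<le> m\<^sup>2"
    unfolding G_def using card_image_le[of "{..<m} \<times> {..<m}" "\<lambda>(a, b). cell m k a b"]
    by (simp add: card_cartesian_product power2_eq_square)
  \<comment> \<open>A set that avoids the grid leaves its cross intact, so it is no block.\<close>
  have "\<exists>i. i \<in> B \<inter> G" if "B \<in> P" for B
  proof (rule ccontr)
    assume none: "\<nexists>i. i \<in> B \<inter> G"
    have "cell m k a b \<notin> B" if "a < m" "b < m" for a b
      using none that by (auto simp: G_def)
    then have "is_cross m (flip x B) k v"
      using cr by (simp add: is_cross_def nth_flip_cell[OF x(1) k])
    then have "has_cross m (flip x B)"
      using k v by (auto simp: has_cross_def)
    then show False using that P x by (auto simp: blocks_def)
  qed
  then obtain g where g: "\<And>B. B \<in> P \<Longrightarrow> g B \<in> B \<inter> G" by metis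
  \<comment> \<open>Disjoint blocks cannot share their chosen cell.\<close>
  have "inj_on g P"
  proof (rule inj_onI)
    fix B B' assume B: "B \<in> P" "B' \<in> P" and "g B = g B'"
    then have "g B \<in> B \<inter> B'" using g[of B] g[of B'] by auto
    then show "B = B'" using P(2) B by (auto simp: disjoint_def)
  qed
  moreover have "g ` P \<subseteq> G" "finite G" using g by (auto simp: G_def)
  ultimately have "card P \<le> card G" by (rule card_inj_on_le)
  then show ?thesis using cardG by simp
qed

lemma card_disjoint_blocks_one_grid:
  assumes x: "length x = (m\<^sup>2)\<^sup>2" "\<not> has_cross m x" and k: "k < m\<^sup>2"
    and Q: "disjoint Q" "\<And>B. B \<in> Q \<Longrightarrow> \<exists>v<m. is_cross m (flip x B) k v"
  shows "card Q \<le> 3"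
proof (rule ccontr)
  assume "\<not> card Q \<le> 3"
  then have "4 \<le> card Q" by simp
  then obtain T where T: "T \<subseteq> Q" "card T = 4"
    by (rule obtain_subset_with_card_n)
  obtain h where h: "\<And>B. B \<in> Q \<Longrightarrow> h B < m \<and> is_cross m (flip x B) k (h B)"
    using Q(2) by metis
  \<comment> \<open>Within grid \<open>k\<close> the block is forced: it flips exactly the cells
    where \<open>x\<close> differs from the cross at \<open>h B\<close>.\<close>
  have mem: "cell m k a b \<in> B \<longleftrightarrow> (x ! cell m k a b) \<noteq> (a = h B \<or> b = h B)"
    if "B \<in> Q" "a < m" "b < m" for a b B
    using h[OF that(1)] nth_flip_cell[OF x(1) k that(2,3), of B] that
    by (auto simp: is_cross_def split: if_splits)
  have apart: False if "B \<in> Q" "B' \<in> Q" "B \<noteq> B'" "i \<in> B" "i \<in> B'" for B B' i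
    using Q(1) that by (auto simp: disjoint_def)
  \<comment> \<open>Blocks that create the same cross agree on the grid, and they flip some cell
    there because \<open>x\<close> has no cross; so they meet.\<close>
  have inj: "h B \<noteq> h B'" if "B \<in> Q" "B' \<in> Q" "B \<noteq> B'" for B B'
  proof
    assume eq: "h B = h B'"
    have "\<not> is_cross m x k (h B)"
      using x(2) k h[OF that(1)] by (auto simp: has_cross_def)
    then obtain a b where ab: "a < m" "b < m" "(x ! cell m k a b) \<noteq> (a = h B \<or> b = h B)"
      by (auto simp: is_cross_def)
    then have "cell m k a b \<in> B" "cell m k a b \<in> B'"
      using mem that eq by auto
    then show False using apart that by blast
  qed
  have "card T = Suc (Suc (Suc (Suc 0)))" using T by simp
  then obtain S T' U V where TT: "T = {S, T', U, V}"
    and dist: "S \<noteq> T'" "S \<noteq> U" "S \<noteq> V" "T' \<noteq> U" "T' \<noteq> V" "U \<noteq> V"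
    unfolding card_Suc_eq by blast
  have inQ: "S \<in> Q" "T' \<in> Q" "U \<in> Q" "V \<in> Q" using T TT by auto
  have lt: "h S < m" "h T' < m" using h inQ by auto
  let ?c = "cell m k (h S) (h T')"
  have ne: "h S \<noteq> h U" "h S \<noteq> h V" "h T' \<noteq> h U" "h T' \<noteq> h V"
    using inj inQ dist by blast+
  show False
  proof (cases "x ! ?c")
    case True
    then have "?c \<in> U" "?c \<in> V" using mem[OF inQ(3) lt] mem[OF inQ(4) lt] ne by auto
    then show ?thesis using apart inQ dist by blast
  next
    case False
    then have "?c \<in> S" "?c \<in> T'" using mem[OF inQ(1) lt] mem[OF inQ(2) lt] by auto
    then show ?thesis using apart inQ dist by blast
  qed
qed

text \<open>The blocks are sorted by the grids in which they create a cross. The classes may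
  overlap, so their sizes are combined by a union bound.\<close>

lemma card_disjoint_blocks_rejected:
  assumes x: "length x = (m\<^sup>2)\<^sup>2" "\<not> has_cross m x"
    and P: "P \<subseteq> blocks ((m\<^sup>2)\<^sup>2) (has_cross m) x" "disjoint P"
  shows "card P \<le> 3 * m\<^sup>2"
proof -
  define Q where "Q k = {B \<in> P. \<exists>v<m. is_cross m (flip x B) k v}" for k
  have "has_cross m (flip x B)" if "B \<in> P" for B
    using that P x by (auto simp: blocks_def)
  then have "P = (\<Union>k<m\<^sup>2. Q k)"
    unfolding Q_def has_cross_def by blast
  then have "card P \<le> (\<Sum>k<m\<^sup>2. card (Q k))"
    using card_UN_le[of "{..<m\<^sup>2}" Q] by simp
  also have "\<dots> \<le> (\<Sum>k<m\<^sup>2. 3)"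
  proof (rule sum_mono)
    fix k assume "k \<in> {..<m\<^sup>2}"
    moreover have "disjoint (Q k)"
      using P(2) by (auto simp: Q_def disjoint_def)
    ultimately show "card (Q k) \<le> 3"
      by (intro card_disjoint_blocks_one_grid[OF x]) (auto simp: Q_def)
  qed
  finally show ?thesis by simp
qed

lemma bs_has_cross_le: "bs ((m\<^sup>2)\<^sup>2) (has_cross m) \<le> 3 * m\<^sup>2"
proof (rule bs_le)
  fix x P
  assume *: "length x = (m\<^sup>2)\<^sup>2" "P \<subseteq> blocks ((m\<^sup>2)\<^sup>2) (has_cross m) x" "disjoint P"
  show "card P \<le> 3 * m\<^sup>2"
  proof (cases "has_cross m x")
    case True
    from card_disjoint_blocks_accepted[OF *(1) this *(2,3)] show ?thesis by simp
  next
    case False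
    from card_disjoint_blocks_rejected[OF *(1) this *(2,3)] show ?thesis .
  qed
qed

section \<open>Lower bound on fractional block sensitivity\<close>

lemma bs_star_has_cross_ge: "real m ^ 3 / 2 \<le> bs_star ((m\<^sup>2)\<^sup>2) (has_cross m)"
proof -
  let ?N = "(m\<^sup>2)\<^sup>2"
  define x where "x = replicate ?N False"
  let ?S = "blocks ?N (has_cross m) x"
  let ?I = "{..<m\<^sup>2} \<times> {..<m}"
  define F where "F = (\<lambda>(k, v). cross m k v) ` ?I"
  define w :: "nat set \<Rightarrow> real" where "w B = (if B \<in> F then 1 / 2 else 0)" for B
  have len: "length x = ?N" by (simp add: x_def)
  have zero: "\<not> x ! cell m k a b" if "k < m\<^sup>2" "a < m" "b < m" for k a b
    using cell_less[OF that] unfolding x_def by (metis nth_replicate)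
  \<comment> \<open>The cross at \<open>v\<close> would need the diagonal cell \<open>(v, v)\<close>
    to be true.\<close>
  have "\<not> is_cross m x k v" if "k < m\<^sup>2" "v < m" for k v
    unfolding is_cross_def using zero[OF that(1) that(2) that(2)] that(2) by blast
  then have rejected: "\<not> has_cross m x"
    unfolding has_cross_def by blast
  have "cross m k v \<in> ?S" if k: "k < m\<^sup>2" and v: "v < m" for k v
  proof -
    have "is_cross m (flip x (cross m k v)) k v"
      by (simp add: is_cross_def nth_flip_cell[OF len k] cell_in_cross_iff zero[OF k])
    then have "has_cross m (flip x (cross m k v))"
      using k v by (auto simp: has_cross_def)
    then show ?thesis
      unfolding blocks_def using rejected cross_subset[OF k] by blast
  qed
  then have sub: "F \<subseteq> ?S" by (auto simp: F_def)
  \<comment> \<open>The diagonal cell \<open>(v, v)\<close> of grid \<open>k\<close> lies in no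
    other cross.\<close>
  have inj: "inj_on (\<lambda>(k, v). cross m k v) ?I"
  proof (rule inj_onI, clarsimp)
    fix k v k' v'
    assume "v < m" and eq: "cross m k v = cross m k' v'"
    then have "cell m k v v \<in> cross m k' v'"
      using cell_in_cross_iff[of v m v k k v] by simp
    then show "k = k' \<and> v = v'" using \<open>v < m\<close> by (simp add: cell_in_cross_iff)
  qed
  have weight: "(\<Sum>B \<in> X. w B) = real (card (X \<inter> F)) / 2" if "finite X" for X
    using that by (simp add: w_def sum.If_cases)
  have "fractional_packing ?N (has_cross m) x w"
    unfolding fractional_packing_def
  proof (intro conjI ballI allI impI)
    fix i assume "i < ?N"
    let ?X = "{B \<in> ?S. i \<in> B}"
    have "card (?X \<inter> F) \<le> 2"
    proof (cases "\<exists>k a b. a < m \<and> b < m \<and> i = cell m k a b")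
      case True
      then obtain k a b where i: "a < m" "b < m" "i = cell m k a b" by blast
      \<comment> \<open>The crosses through cell \<open>(a, b)\<close> are those at \<open>a\<close>
        and \<open>b\<close>, which coincide on the diagonal.\<close>
      then have "?X \<inter> F \<subseteq> {cross m k a, cross m k b}"
        by (auto simp: F_def cell_in_cross_iff)
      then have "card (?X \<inter> F) \<le> card {cross m k a, cross m k b}"
        by (intro card_mono) auto
      also have "\<dots> \<le> 2" by (simp add: card_insert_if)
      finally show ?thesis .
    next
      case False
      then have "?X \<inter> F = {}" by (auto simp: F_def cross_def)
      then show ?thesis by simp
    qed
    then show "(\<Sum>B \<in> ?X. w B) \<le> 1"
      by (subst weight) (auto simp: finite_blocks)
  qed (simp add: w_def)
  from bs_star_ge[OF len this]
  have "real (card (?S \<inter> F)) / 2 \<le> bs_star ?N (has_cross m)"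
    by (simp add: weight finite_blocks)
  moreover have "?S \<inter> F = F" using sub by blast
  moreover have "card F = m ^ 3"
    unfolding F_def card_image[OF inj]
    by (simp add: card_cartesian_product power2_eq_square power3_eq_cube)
  ultimately show ?thesis by simp
qed

section \<open>The critical exponent\<close>

lemma le_exp_bs_star_bs_imp:
  assumes "le_exp r bs_star (\<lambda>N f. real (bs N f))"
  shows "3 / 2 \<le> r"
proof (rule ccontr)
  assume "\<not> 3 / 2 \<le> r"
  \<comment> \<open>A nonnegative exponent makes \<open>powr\<close> monotone in its base, also when
    \<open>r\<close> is negative.\<close>
  define s where "s = max r 0"
  have s: "0 \<le> s" "s < 3 / 2" "r \<le> s" using \<open>\<not> 3 / 2 \<le> r\<close> by (auto simp: s_def)
  obtain C D where CD: "\<And>N f. bs_star N f \<le> C * real (bs N f) powr r + D"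
    using assms by (auto simp: le_exp_def)
  have bound: "real m ^ 3 / 2 \<le> \<bar>C\<bar> * (3 * (real m)\<^sup>2) powr s + D" for m
  proof -
    let ?b = "bs ((m\<^sup>2)\<^sup>2) (has_cross m)"
    \<comment> \<open>A natural number is either 0, where both powers vanish, or at least 1, where
      \<open>powr\<close> grows with the exponent.\<close>
    have "real ?b powr r \<le> real ?b powr s"
      using s(3) by (cases "?b = 0") (auto intro: powr_mono)
    also have "real ?b \<le> 3 * (real m)\<^sup>2"
      using bs_has_cross_le[of m] by (metis of_nat_le_iff of_nat_mult of_nat_numeral of_nat_power)
    then have "real ?b powr s \<le> (3 * (real m)\<^sup>2) powr s"
      using s(1) by (intro powr_mono2) auto
    finally have "C * real ?b powr r \<le> \<bar>C\<bar> * (3 * (real m)\<^sup>2) powr s"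
      by (intro mult_mono) auto
    then show ?thesis
      using bs_star_has_cross_ge[of m] CD[of "(m\<^sup>2)\<^sup>2" "has_cross m"] by linarith
  qed
  \<comment> \<open>Since \<open>m powr (2 * s)\<close> is at least 1, it absorbs the additive
    constant; dividing by it leaves a positive power of \<open>m\<close> bounded by
    \<open>K\<close>.\<close>
  define K where "K = 2 * (\<bar>C\<bar> * 3 powr s + \<bar>D\<bar>)"
  have upper: "real m powr (3 - 2 * s) \<le> K" if "m > 0" for m
  proof -
    have cubed: "real m ^ 3 = real m powr 3" by simp
    have "(3 * (real m)\<^sup>2) powr s = 3 powr s * (real m powr 2) powr s"
      by (simp add: powr_mult)
    then have pow: "(3 * (real m)\<^sup>2) powr s = 3 powr s * real m powr (2 * s)"
      by (simp only: powr_powr)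
    have "1 \<le> real m powr (2 * s)"
      using that s by (intro ge_one_powr_ge_zero) auto
    then have "\<bar>D\<bar> \<le> \<bar>D\<bar> * real m powr (2 * s)"
      using mult_left_mono[of 1 "real m powr (2 * s)" "\<bar>D\<bar>"] by simp
    then have "real m powr 3 \<le> K * real m powr (2 * s)"
      using bound[of m] unfolding cubed pow K_def by (simp add: algebra_simps)
    then show ?thesis
      using that by (simp add: powr_diff field_simps)
  qed
  \<comment> \<open>The base \<open>\<bar>K\<bar> + 1\<close> is positive, so raising to the power
    \<open>3 - 2 * s\<close> cancels the root.\<close>
  obtain m where m: "(\<bar>K\<bar> + 1) powr (1 / (3 - 2 * s)) < real m"
    using reals_Archimedean2 by blast
  then have "((\<bar>K\<bar> + 1) powr (1 / (3 - 2 * s))) powr (3 - 2 * s) < real m powr (3 - 2 * s)"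
    using s by (intro powr_less_mono2) auto
  then have "K < real m powr (3 - 2 * s)"
    using s by (simp add: powr_powr)
  moreover have "m > 0"
    using m by (cases m) auto
  ultimately show False using upper[of m] by simp
qed

theorem mainTheorem5:
  "(\<exists>c c' :: real. c > 0 \<and> c' > 0 \<and>
      infinite {n :: nat. \<exists>f :: bool list \<Rightarrow> bool.
        real (bs (n\<^sup>2) f) \<le> c * real n \<and> bs_star (n\<^sup>2) f \<ge> c' * real n powr (3 / 2)})
   \<and> crit bs_star (\<lambda>N f. real (bs N f)) \<ge> ereal (3 / 2)"
proof
  let ?A = "{n :: nat. \<exists>f :: bool list \<Rightarrow> bool.
    real (bs (n\<^sup>2) f) \<le> 3 * real n \<and> bs_star (n\<^sup>2) f \<ge> 1 / 2 * real n powr (3 / 2)}"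
  \<comment> \<open>Every square \<open>n\<close> works, with \<open>n powr (3 / 2)\<close> equal to
    the cube of \<open>m\<close>.\<close>
  have "m\<^sup>2 \<in> ?A" for m
  proof -
    have "real (m\<^sup>2) powr (3 / 2) = real m ^ 3"
    proof -
      have "real (m\<^sup>2) = real m powr 2" by simp
      then have "real (m\<^sup>2) powr (3 / 2) = real m powr (2 * (3 / 2))"
        by (simp only: powr_powr)
      then show ?thesis by simp
    qed
    moreover have "real (bs ((m\<^sup>2)\<^sup>2) (has_cross m)) \<le> 3 * real (m\<^sup>2)"
      using bs_has_cross_le[of m] by (metis of_nat_le_iff of_nat_mult of_nat_numeral)
    ultimately show ?thesis
      using bs_star_has_cross_ge[of m] by (auto intro!: exI[of _ "has_cross m"])
  qed
  then have "range (\<lambda>m::nat. m\<^sup>2) \<subseteq> ?A" by blast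
  moreover have "infinite (range (\<lambda>m::nat. m\<^sup>2))"
    by (intro range_inj_infinite injI) simp
  ultimately have "infinite ?A" by (metis (lifting) finite_subset)
  then show "\<exists>c c' :: real. c > 0 \<and> c' > 0 \<and>
      infinite {n :: nat. \<exists>f :: bool list \<Rightarrow> bool.
        real (bs (n\<^sup>2) f) \<le> c * real n \<and> bs_star (n\<^sup>2) f \<ge> c' * real n powr (3 / 2)}"
    by (intro exI[of _ 3] exI[of _ "1 / 2"]) simp
  \<comment> \<open>A lower bound on all admissible exponents suffices, even if there are none and
    the infimum is infinite.\<close>
  show "crit bs_star (\<lambda>N f. real (bs N f)) \<ge> ereal (3 / 2)"
    unfolding crit_def by (rule Inf_greatest) (auto dest: le_exp_bs_star_bs_imp)
qed

end
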